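(* Let $x$ and $y$ be two states of an LTS. Then $x \sqsubseteq_{must} y$ iff $[\![\{y\}]\!] \sqsubseteq_{\mathcal{M}} [\![\{x\}]\!]$, and $x\sim_{must}y$ iff $[\![\{x\}]\!]=[\![\{y\}]\!]$.
   Context: Consider an LTS with state set $S$ over $A\cup\{\tau\}$. Write $\xRightarrow{\varepsilon}$ for $\xrightarrow{\tau}^*$ and $\xRightarrow{a}$ for $\xrightarrow{\tau}^*\xrightarrow{a}\xrightarrow{\tau}^*$, extended to words. $x$ diverges ($x\not\downarrow$) if it can perform an infinite sequence of $\tau$-steps; $x\downarrow\varepsilon$ iff $x$ does not diverge, and $x\downarrow aw$ iff $x\downarrow\varepsilon$ and $x'\downarrow w$ for every $x'$ with $x\xRightarrow{a}x'$. The acceptance set is $A(x,w)=\{\{a\in A\mid x'\xrightarrow{a}\}\mid x\xRightarrow{w}x',\ x'\not\xrightarrow{\tau}\}$. For $B,C\subseteq\mathcal{P}(A)$, $B\subset\subset C$ iff for every $B_i\in B$ there is $C_i\in C$ with $C_i\subseteq B_i$. Must preorder: $x\sqsubseteq_{must}y$ iff for all $w\in A^*$, if $x\downarrow w$ then $y\downarrow w$ and $A(y,w)\subset\subset A(x,w)$; $x\sim_{must}y$ iff $x\sqsubseteq_{must}y$ and $y\sqsubseteq_{must}x$. Coalgebraic model: $t\colon S\to(1+\mathcal{P}_\omega S)^A$ with $1=\{\top\}$, $t(x)(a)=\top$ if $x\not\downarrow a$, otherwise $t(x)(a)=\{y\mid x\xRightarrow{a}y\}$; output $o\colon S\to 1+\mathcal{P}_\omega(\mathcal{P}_\omega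 A)$ with $o(x)=\top$ if $x\not\downarrow$, $o(x)=\bigcup_{x\xrightarrow{\tau}x'}o(x')$ if $x\xrightarrow{\tau}$, and $o(x)=\{Z\subseteq A\mid Z\cap\{a\mid t(x)(a)\neq\emptyset\}=\emptyset\}$ otherwise. On $1+\mathcal{P}(U)$ the join $\sqcup$ is union on subsets, with $\top\sqcup X=X\sqcup\top=\top$, bottom $\emptyset$. The determinisation on $1+\mathcal{P}_\omega S$ is $o^\sharp(\top)=\top$, $o^\sharp(X)=\bigsqcup_{x\in X}o(x)$, $t^\sharp(\top)(a)=\top$, $t^\sharp(X)(a)=\bigsqcup_{x\in X}t(x)(a)$; $[\![-]\!]\colon 1+\mathcal{P}_\omega S\to(1+\mathcal{P}_\omega(\mathcal{P}_\omega A))^{A^*}$ is given by $[\![X]\!](\varepsilon)=o^\sharp(X)$, $[\![X]\!](aw)=[\![t^\sharp(X)(a)]\!](w)$. $\sqsubseteq_{\mathcal{M}}$ is the preorder induced by the pointwise (on $A^*$) join: $f\sqsubseteq_{\mathcal{M}}g$ iff $f\sqcup g=g$. *)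

theory Defs
  imports "HOL-Library.Lattice_Constructions"
begin

datatype 'a action = Tau | Act 'a

type_synonym ('s, 'a) lts = "'s \<Rightarrow> 'a action \<Rightarrow> 's \<Rightarrow> bool"

definition tau_step :: "('s, 'a) lts \<Rightarrow> 's \<Rightarrow> 's \<Rightarrow> bool" where
  "tau_step T x y \<longleftrightarrow> T x Tau y"

definition weak_eps :: "('s, 'a) lts \<Rightarrow> 's \<Rightarrow> 's \<Rightarrow> bool" where
  "weak_eps T = (tau_step T)\<^sup>*\<^sup>*"

definition weak_act :: "('s, 'a) lts \<Rightarrow> 'a \<Rightarrow> 's \<Rightarrow> 's \<Rightarrow> bool" where
  "weak_act T a x y \<longleftrightarrow>
     (\<exists>x' y'. weak_eps T x x' \<and> T x' (Act a) y' \<and> weak_eps T y' y)"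

primrec weak_word :: "('s, 'a) lts \<Rightarrow> 'a list \<Rightarrow> 's \<Rightarrow> 's \<Rightarrow> bool" where
  "weak_word T [] x y \<longleftrightarrow> weak_eps T x y"
| "weak_word T (a # w) x y \<longleftrightarrow> (\<exists>z. weak_act T a x z \<and> weak_word T w z y)"

definition stable :: "('s, 'a) lts \<Rightarrow> 's \<Rightarrow> bool" where
  "stable T x \<longleftrightarrow> \<not> (\<exists>x'. tau_step T x x')"

definition diverges :: "('s, 'a) lts \<Rightarrow> 's \<Rightarrow> bool" where
  "diverges T x \<longleftrightarrow> (\<exists>f :: nat \<Rightarrow> 's. f 0 = x \<and> (\<forall>i. tau_step T (f i) (f (Suc i))))"

primrec converges :: "('s, 'a) lts \<Rightarrow> 's \<Rightarrow> 'a list \<Rightarrow> bool" where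
  "converges T x [] \<longleftrightarrow> \<not> diverges T x"
| "converges T x (a # w) \<longleftrightarrow>
     \<not> diverges T x \<and> (\<forall>x'. weak_act T a x x' \<longrightarrow> converges T x' w)"

definition initials :: "('s, 'a) lts \<Rightarrow> 's \<Rightarrow> 'a set" where
  "initials T x = {a. \<exists>x'. T x (Act a) x'}"

definition acceptance :: "('s, 'a) lts \<Rightarrow> 's \<Rightarrow> 'a list \<Rightarrow> 'a set set" where
  "acceptance T x w = {initials T x' | x'. weak_word T w x x' \<and> stable T x'}"

definition ssubset :: "'a set set \<Rightarrow> 'a set set \<Rightarrow> bool" (infix "\<subset>\<subset>" 50) where
  "B \<subset>\<subset> C \<longleftrightarrow> (\<forall>Bi \<in> B. \<exists>Ci \<in> C. Ci \<subseteq> Bi)"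

definition must_le :: "('s, 'a) lts \<Rightarrow> 's \<Rightarrow> 's \<Rightarrow> bool" where
  "must_le T x y \<longleftrightarrow>
     (\<forall>w. converges T x w \<longrightarrow> converges T y w \<and> acceptance T y w \<subset>\<subset> acceptance T x w)"

definition must_eq :: "('s, 'a) lts \<Rightarrow> 's \<Rightarrow> 's \<Rightarrow> bool" where
  "must_eq T x y \<longleftrightarrow> must_le T x y \<and> must_le T y x"

text \<open>
  \<open>1 + P(U)\<close> is the type \<open>'u set top\<close>: \<open>top.Top\<close> is the element of \<open>1\<close> and \<open>top.Value X\<close> is the
  subset \<open>X\<close>. The library's \<open>sup\<close> on this type is the binary join (union on subsets, with
  \<open>Top\<close> absorbing) and its \<open>bot\<close> is the empty subset. The library has no join of families for it.
\<close>

definition Join :: "'u set top set \<Rightarrow> 'u set top" where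
  "Join F = (if top.Top \<in> F then top.Top else top.Value (\<Union>{X. top.Value X \<in> F}))"

lemma sup_top_eqs:
  "sup (top.Value X) (top.Value Y) = (top.Value (X \<union> Y) :: 'u set top)"
  "sup top.Top v = (top.Top :: 'u set top)"
  "sup v top.Top = (top.Top :: 'u set top)"
  "(bot :: 'u set top) = top.Value {}"
  by (auto simp: sup_top_def bot_top_def split: top.split)

lemma Join_empty: "Join {} = bot"
  by (simp add: Join_def sup_top_eqs)

lemma Join_insert: "Join (insert v F) = sup v (Join F)"
  by (cases v) (auto simp: Join_def sup_top_eqs)

lemma Join_cong [fundef_cong]:
  "A = B \<Longrightarrow> (\<And>x. x \<in> B \<Longrightarrow> f x = g x) \<Longrightarrow> Join (f ` A) = Join (g ` B)"
  by (metis image_cong)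

text \<open>
  Subsets are not required to be finite, so the definitions make sense for every LTS. The lemmas
  \<open>finite_coalg_trans\<close> and \<open>finite_coalg_out\<close> below show that for a finite alphabet and a finitely branching
  LTS the values lie in \<open>1 + P\<^sub>\<omega>(S)\<close> and \<open>1 + P\<^sub>\<omega>(P\<^sub>\<omega>(A))\<close>; \<open>finite_det_trans\<close> shows
  that the determinisation preserves \<open>1 + P\<^sub>\<omega>(S)\<close>.
\<close>

definition coalg_trans :: "('s, 'a) lts \<Rightarrow> 's \<Rightarrow> 'a \<Rightarrow> 's set top" where
  "coalg_trans T x a =
     (if \<not> converges T x [a] then top.Top else top.Value {y. weak_act T a x y})"

lemma wf_convergent_tau:
  "wf {((T, x'), (T, x)) | (T :: ('s, 'a) lts) x x'. \<not> diverges T x \<and> tau_step T x x'}"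
  (is "wf ?R")
  unfolding wf_iff_no_infinite_down_chain
proof
  assume "\<exists>f. \<forall>i. (f (Suc i), f i) \<in> ?R"
  then obtain f :: "nat \<Rightarrow> ('s, 'a) lts \<times> 's" where f: "\<And>i. (f (Suc i), f i) \<in> ?R"
    by blast
  have same: "fst (f (Suc i)) = fst (f i)" and conv: "\<not> diverges (fst (f i)) (snd (f i))"
    and tau: "tau_step (fst (f i)) (snd (f i)) (snd (f (Suc i)))" for i
    using f[of i] by auto
  have "fst (f 0) = fst (f i)" for i
    by (induction i) (simp_all add: same)
  then have "tau_step (fst (f 0)) (snd (f i)) (snd (f (Suc i)))" for i
    by (metis tau)
  then have "diverges (fst (f 0)) (snd (f 0))"
    unfolding diverges_def by (intro exI[of _ "\<lambda>i. snd (f i)"]) simp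
  then show False using conv by blast
qed

function coalg_out :: "('s, 'a) lts \<Rightarrow> 's \<Rightarrow> 'a set set top" where
  "coalg_out T x =
     (if diverges T x then top.Top
      else if \<exists>x'. tau_step T x x' then Join (coalg_out T ` {x'. tau_step T x x'})
      else top.Value {Z. Z \<inter> {a. coalg_trans T x a \<noteq> top.Value {}} = {}})"
  by pat_completeness auto
termination
  by (relation "{((T, x'), (T, x)) | T x x'. \<not> diverges T x \<and> tau_step T x x'}")
    (auto intro: wf_convergent_tau)

declare coalg_out.simps [simp del]

fun det_out :: "('s, 'a) lts \<Rightarrow> 's set top \<Rightarrow> 'a set set top" where
  "det_out T top.Top = top.Top"
| "det_out T (top.Value X) = Join (coalg_out T ` X)"

fun det_trans :: "('s, 'a) lts \<Rightarrow> 's set top \<Rightarrow> 'a \<Rightarrow> 's set top" where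
  "det_trans T top.Top a = top.Top"
| "det_trans T (top.Value X) a = Join ((\<lambda>x. coalg_trans T x a) ` X)"

primrec sem :: "('s, 'a) lts \<Rightarrow> 's set top \<Rightarrow> 'a list \<Rightarrow> 'a set set top" where
  "sem T X [] = det_out T X"
| "sem T X (a # w) = sem T (det_trans T X a) w"

text \<open>
  The join of functions on words is the library's pointwise \<open>sup\<close>.
\<close>

definition sem_le :: "('a list \<Rightarrow> 'a set set top) \<Rightarrow> ('a list \<Rightarrow> 'a set set top) \<Rightarrow> bool"
    (infix "\<sqsubseteq>\<^sub>M" 50) where
  "f \<sqsubseteq>\<^sub>M g \<longleftrightarrow> sup f g = g"

definition finitely_branching :: "('s, 'a) lts \<Rightarrow> bool" where
  "finitely_branching T \<longleftrightarrow> (\<forall>x l. finite {y. T x l y})"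

definition fin_top :: "'u set top \<Rightarrow> bool" where
  "fin_top v \<longleftrightarrow> (\<forall>X. v = top.Value X \<longrightarrow> finite X)"

lemma finite_coalg_out:
  fixes T :: "('s, 'a :: finite) lts"
  shows "fin_top (coalg_out T x)" and "coalg_out T x = top.Value F \<Longrightarrow> Z \<in> F \<Longrightarrow> finite Z"
  by (simp_all add: fin_top_def)

lemma finite_weak_eps:
  assumes T: "finitely_branching T" and x: "\<not> diverges T x"
  shows "finite {y. weak_eps T x y}"
proof (rule ccontr)
  assume inf: "\<not> finite {y. weak_eps T x y}"
  let ?P = "\<lambda>x. infinite {y. weak_eps T x y}"
  have step: "\<exists>x'. ?P x' \<and> tau_step T x x'" if "?P x" for x
  proof (rule ccontr)
    assume "\<not> (\<exists>x'. ?P x' \<and> tau_step T x x')"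
    moreover have "finite {x'. tau_step T x x'}"
      using T by (simp add: finitely_branching_def tau_step_def)
    ultimately have "finite (\<Union>x' \<in> {x'. tau_step T x x'}. {y. weak_eps T x' y})"
      by auto
    moreover have "{y. weak_eps T x y}
        \<subseteq> insert x (\<Union>x' \<in> {x'. tau_step T x x'}. {y. weak_eps T x' y})"
      by (auto simp: weak_eps_def elim: converse_rtranclpE)
    ultimately show False
      using that by (meson finite_insert finite_subset)
  qed
  have "\<exists>f. \<forall>n. (?P (f n) \<and> (n = 0 \<longrightarrow> f n = x)) \<and> tau_step T (f n) (f (Suc n))"
  proof (rule dependent_nat_choice)
    show "\<exists>y. ?P y \<and> ((0 :: nat) = 0 \<longrightarrow> y = x)"
      using inf by blast
    show "\<exists>z. (?P z \<and> (Suc n = 0 \<longrightarrow> z = x)) \<and> tau_step T y z"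
      if "?P y \<and> (n = 0 \<longrightarrow> y = x)" for y and n :: nat
      using step that by simp
  qed
  then show False using x unfolding diverges_def by blast
qed

lemma finite_coalg_trans:
  assumes T: "finitely_branching T"
  shows "fin_top (coalg_trans T x a)"
proof (cases "converges T x [a]")
  case True
  let ?X = "{x'. weak_eps T x x'}"
  let ?Y = "\<Union>x' \<in> ?X. {y'. T x' (Act a) y'}"
  have "finite ?Y"
    using T True finite_weak_eps[OF T, of x] by (auto simp: finitely_branching_def)
  moreover have "\<not> diverges T y'" if "y' \<in> ?Y" for y'
  proof -
    have "weak_act T a x y'" using that by (auto simp: weak_act_def weak_eps_def)
    then show ?thesis using True by simp
  qed
  ultimately have "finite (\<Union>y' \<in> ?Y. {y. weak_eps T y' y})"
    using finite_weak_eps[OF T] by blast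
  moreover have "{y. weak_act T a x y} \<subseteq> (\<Union>y' \<in> ?Y. {y. weak_eps T y' y})"
    by (auto simp: weak_act_def)
  ultimately have "finite {y. weak_act T a x y}"
    by (rule rev_finite_subset)
  then show ?thesis
    using True by (simp add: fin_top_def coalg_trans_def del: converges.simps)
qed (simp add: fin_top_def coalg_trans_def del: converges.simps)

lemma finite_det_trans:
  assumes T: "finitely_branching T" and X: "fin_top X"
  shows "fin_top (det_trans T X a)"
proof (cases X)
  case (Value Y)
  then have "finite Y" using X by (simp add: fin_top_def)
  then have "fin_top (Join ((\<lambda>x. coalg_trans T x a) ` Y))"
  proof induction
    case empty
    show ?case by (simp add: fin_top_def Join_empty sup_top_eqs)
  next
    case (insert x F)
    then show ?case
      using finite_coalg_trans[OF T, of x a]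
      by (cases "coalg_trans T x a"; cases "Join ((\<lambda>x. coalg_trans T x a) ` F)")
        (auto simp: fin_top_def Join_insert sup_top_eqs)
  qed
  then show ?thesis using Value by simp
qed (simp add: fin_top_def)

end

theory Submission
  imports Defs
begin

text \<open>
  On every word along which \<open>x\<close> converges, the semantics of \<open>{x}\<close> is the family of all sets that are
  disjoint from some member of the acceptance set, and it is \<open>Top\<close> on all other words. Inclusion of
  two such families is the relation \<open>\<subset>\<subset>\<close> between the acceptance sets: for one
  direction, test the inclusion on the complement of a member.
\<close>

definition refusals :: "'a set set \<Rightarrow> 'a set set" where
  "refusals B = {Z. \<exists>I \<in> B. Z \<inter> I = {}}"

lemma refusals_subset_iff: "refusals B \<subseteq> refusals C \<longleftrightarrow> B \<subset>\<subset> C"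
proof
  assume sub: "refusals B \<subseteq> refusals C"
  show "B \<subset>\<subset> C"
    unfolding ssubset_def
  proof
    fix I assume "I \<in> B"
    then have "- I \<in> refusals B" by (auto simp: refusals_def)
    then have "- I \<in> refusals C" using sub by blast
    then show "\<exists>J \<in> C. J \<subseteq> I" by (auto simp: refusals_def)
  qed
next
  assume "B \<subset>\<subset> C"
  show "refusals B \<subseteq> refusals C"
  proof
    fix Z assume "Z \<in> refusals B"
    then obtain I where "I \<in> B" and "Z \<inter> I = {}"
      by (auto simp: refusals_def)
    moreover obtain J where "J \<in> C" and "J \<subseteq> I"
      using \<open>B \<subset>\<subset> C\<close> \<open>I \<in> B\<close> unfolding ssubset_def by metis
    ultimately show "Z \<in> refusals C"
      unfolding refusals_def by blast
  qed
qed

definition refusal_sem :: "('s, 'a) lts \<Rightarrow> 's \<Rightarrow> 'a list \<Rightarrow> 'a set set top" where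
  "refusal_sem T x w =
     (if converges T x w then top.Value (refusals (acceptance T x w)) else top.Top)"

lemma Join_image_refusal_sem:
  "Join ((\<lambda>x. refusal_sem T x w) ` X) =
     (if \<forall>x \<in> X. converges T x w
      then top.Value (\<Union>x \<in> X. refusals (acceptance T x w)) else top.Top)"
  by (auto simp: Join_def refusal_sem_def image_iff split: if_splits)

text \<open>Prefixing \<open>x\<close> to an infinite run from \<open>x'\<close> gives one from
  \<open>x\<close>. Read contrapositively, convergence passes to tau successors.\<close>

lemma diverges_if_tau_step:
  assumes "tau_step T x x'" "diverges T x'"
  shows "diverges T x"
proof -
  obtain f where f: "f 0 = x'" "\<And>i. tau_step T (f i) (f (Suc i))"
    using assms(2) unfolding diverges_def by blast
  have "tau_step T (case_nat x f i) (case_nat x f (Suc i))" for i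
    using f assms(1) by (cases i) auto
  then show ?thesis
    unfolding diverges_def by (intro exI[of _ "case_nat x f"]) simp
qed

lemma weak_eps_stable: "stable T x \<Longrightarrow> weak_eps T x y \<longleftrightarrow> y = x"
  by (auto simp: weak_eps_def stable_def elim: converse_rtranclpE)

lemma acceptance_Nil_stable: "stable T x \<Longrightarrow> acceptance T x [] = {initials T x}"
  by (auto simp: acceptance_def weak_eps_stable)

text \<open>An unstable \<open>x\<close> contributes no member itself, so every path to a
  contributing state starts with a tau step. This mirrors the recursion of
  \<open>coalg_out\<close>.\<close>

lemma acceptance_Nil_unstable:
  assumes "\<not> stable T x"
  shows "acceptance T x [] = (\<Union>x' \<in> {x'. tau_step T x x'}. acceptance T x' [])"
proof -
  have "weak_eps T x z \<and> stable T z \<longleftrightarrow> (\<exists>x'. tau_step T x x' \<and> weak_eps T x' z \<and> stable T z)" for z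
    using assms unfolding weak_eps_def
    by (metis converse_rtranclpE converse_rtranclp_into_rtranclp)
  then show ?thesis unfolding acceptance_def by auto
qed

lemma acceptance_Cons:
  "acceptance T x (a # w) = (\<Union>x' \<in> {x'. weak_act T a x x'}. acceptance T x' w)"
  by (auto simp: acceptance_def)

text \<open>Membership in \<open>refusals\<close> asks for a single witness, so it distributes over
  unions and hence matches \<open>Join\<close> on \<open>Value\<close> families.\<close>

lemma refusals_UN: "refusals (\<Union>i \<in> I. B i) = (\<Union>i \<in> I. refusals (B i))"
  by (auto simp: refusals_def)

text \<open>
  In a stable convergent state, a \<open>Top\<close> value of \<open>coalg_trans\<close> comes from divergence after an
  \<open>a\<close>-step, so being different from the empty set still detects enabledness.
\<close>

lemma coalg_trans_nonempty_iff:
  assumes "stable T x" "\<not> diverges T x"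
  shows "coalg_trans T x a \<noteq> top.Value {} \<longleftrightarrow> a \<in> initials T x"
proof -
  have "(\<exists>y. weak_act T a x y) \<longleftrightarrow> a \<in> initials T x"
    using assms(1) by (auto simp: weak_act_def weak_eps_stable initials_def)
      (auto simp: weak_eps_def)
  then show ?thesis using assms(2) by (auto simp: coalg_trans_def)
qed

text \<open>The induction follows the recursion of \<open>coalg_out\<close>, which is well founded
  on tau steps out of convergent states. A stable state has its initials as only acceptance member;
  an unstable one collects those of its successors.\<close>

lemma coalg_out_eq: "coalg_out T x = refusal_sem T x []"
proof (induction T x rule: coalg_out.induct)
  case (1 T x)
  show ?case
  proof (cases "diverges T x")
    case True
    then show ?thesis by (simp add: coalg_out.simps[of T x] refusal_sem_def)
  next
    case conv: False
    show ?thesis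
    proof (cases "stable T x")
      case True
      then show ?thesis
        using conv
        by (auto simp: coalg_out.simps[of T x] refusal_sem_def refusals_def stable_def
            acceptance_Nil_stable coalg_trans_nonempty_iff)
    next
      case False
      let ?X = "{x'. tau_step T x x'}"
      have "\<exists>x'. tau_step T x x'" using False by (simp add: stable_def)
      then have "coalg_out T x = Join (coalg_out T ` ?X)"
        using conv by (simp add: coalg_out.simps[of T x])
      also have "\<dots> = Join ((\<lambda>x'. refusal_sem T x' []) ` ?X)"
        using 1 conv False by (intro Join_cong) (auto simp: stable_def)
      also have "\<dots> = refusal_sem T x []"
        \<comment> \<open>Since \<open>x\<close> converges, so do its tau successors, and no
          \<open>Top\<close> enters the join.\<close>
        using conv diverges_if_tau_step[of T x]
        by (auto simp: Join_image_refusal_sem refusal_sem_def[of T x]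
            acceptance_Nil_unstable[OF False] refusals_UN)
      finally show ?thesis .
    qed
  qed
qed

lemma converges_imp_not_diverges: "converges T x w \<Longrightarrow> \<not> diverges T x"
  by (cases w) auto

text \<open>Convergence of the successors along \<open>w\<close> already excludes their divergence.
  This separates the test made by \<open>coalg_trans\<close> from the rest of the word.\<close>

lemma converges_Cons_iff:
  "converges T x (a # w) \<longleftrightarrow>
     converges T x [a] \<and> (\<forall>x'. weak_act T a x x' \<longrightarrow> converges T x' w)"
  by (auto dest: converges_imp_not_diverges)

lemma sem_Top: "sem T top.Top w = top.Top"
  by (induction w) auto

lemma det_trans_Value:
  "det_trans T (top.Value X) a =
     (if \<forall>x \<in> X. converges T x [a]
      then top.Value (\<Union>x \<in> X. {y. weak_act T a x y}) else top.Top)"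
  by (auto simp: Join_def coalg_trans_def image_iff simp del: converges.simps split: if_splits)

text \<open>Stated for arbitrary \<open>X\<close> because reading a letter turns even a singleton
  into its set of weak successors.\<close>

lemma sem_Value: "sem T (top.Value X) w = Join ((\<lambda>x. refusal_sem T x w) ` X)"
proof (induction w arbitrary: X)
  case Nil
  show ?case by (simp add: coalg_out_eq)
next
  case (Cons a w)
  show ?case
  proof (cases "\<forall>x \<in> X. converges T x [a]")
    case True
    \<comment> \<open>With the first letter safe, the two joins are \<open>Top\<close> under the
      same condition; otherwise their unions agree after regrouping by successors.\<close>
    have "(\<forall>x \<in> X. converges T x (a # w)) \<longleftrightarrow>
        (\<forall>y \<in> (\<Union>x \<in> X. {y. weak_act T a x y}). converges T y w)"
      using True converges_Cons_iff[of T _ a w] by blast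
    moreover have "sem T (top.Value X) (a # w) =
        Join ((\<lambda>y. refusal_sem T y w) ` (\<Union>x \<in> X. {y. weak_act T a x y}))"
      by (simp only: sem.simps det_trans_Value if_P[OF True] Cons.IH)
    ultimately show ?thesis
      unfolding Join_image_refusal_sem acceptance_Cons refusals_UN by auto
  next
    case False
    then have "\<not> (\<forall>x \<in> X. converges T x (a # w))"
      using converges_Cons_iff[of T _ a w] by blast
    then have "Join ((\<lambda>x. refusal_sem T x (a # w)) ` X) = top.Top"
      unfolding Join_image_refusal_sem by (rule if_not_P)
    \<comment> \<open>A \<open>Top\<close> reached on the first letter persists along
      \<open>w\<close>.\<close>
    then show ?thesis
      using False by (metis sem.simps(2) det_trans_Value sem_Top)
  qed
qed

lemma sem_singleton: "sem T (top.Value {x}) w = refusal_sem T x w"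
  by (simp add: sem_Value Join_insert Join_empty sup_top_eqs(4))
    (simp add: refusal_sem_def sup_top_eqs)

text \<open>If \<open>x\<close> fails to converge along \<open>w\<close>, \<open>Top\<close> absorbs
  the join and the implication is vacuous. Otherwise the join must be a \<open>Value\<close>, which
  forces \<open>y\<close> to converge and leaves inclusion of refusals.\<close>

lemma sup_refusal_sem_eq_iff:
  "sup (refusal_sem T y w) (refusal_sem T x w) = refusal_sem T x w \<longleftrightarrow>
     (converges T x w \<longrightarrow> converges T y w \<and> acceptance T y w \<subset>\<subset> acceptance T x w)"
  by (simp add: refusal_sem_def sup_top_eqs refusals_subset_iff[symmetric] subset_Un_eq)

lemma must_le_iff: "must_le T x y \<longleftrightarrow> sem T (top.Value {y}) \<sqsubseteq>\<^sub>M sem T (top.Value {x})"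
  by (simp add: must_le_def sem_le_def fun_eq_iff sem_singleton sup_refusal_sem_eq_iff)

text \<open>Both joins are the same function by commutativity; the converse is idempotence.\<close>

lemma sem_le_antisym: "f \<sqsubseteq>\<^sub>M g \<and> g \<sqsubseteq>\<^sub>M f \<longleftrightarrow> g = f"
  unfolding sem_le_def by (metis sup_commute sup_idem)

theorem theorem4p10:
  fixes T :: "('s, 'a) lts" and x y :: 's
  shows "(must_le T x y \<longleftrightarrow> sem T (top.Value {y}) \<sqsubseteq>\<^sub>M sem T (top.Value {x})) \<and>
         (must_eq T x y \<longleftrightarrow> sem T (top.Value {x}) = sem T (top.Value {y}))"
  by (simp add: must_eq_def must_le_iff sem_le_antisym)

end
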